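(* For any directed graph $G$ on $n$ vertices and $m$ edges with positive real capacities, a designated source vertex $s$ and a designated sink vertex $t$, there is an algorithm that, given any edge $e$ of $G$, uses two maximum $(s,t)$-flow computations to compute a maximum $(s,t)$-flow $f$ such that $f(e)\ge f'(e)$ for every maximum $(s,t)$-flow $f'$ in $G$.
   Context: $f(e)$ denotes the flow carried by edge $e$ under the flow $f$. *)

theory Defs
  imports "HOL-Analysis.Analysis" "Graph_Theory.Digraph"
begin

section \<open>Maximum flows\<close>

text \<open>Digraphs are the multigraphs of the library: parallel arcs and loops are allowed.\<close>

definition flow_network ::
    "('a, 'b) pre_digraph \<Rightarrow> ('b \<Rightarrow> real) \<Rightarrow> 'a \<Rightarrow> 'a \<Rightarrow> bool" where
  "flow_network G c s t \<longleftrightarrow>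
     fin_digraph G \<and> (\<forall>e\<in>arcs G. 0 < c e) \<and> s \<in> verts G \<and> t \<in> verts G \<and> s \<noteq> t"

definition is_flow ::
    "('a, 'b) pre_digraph \<Rightarrow> ('b \<Rightarrow> real) \<Rightarrow> 'a \<Rightarrow> 'a \<Rightarrow> ('b \<Rightarrow> real) \<Rightarrow> bool" where
  "is_flow G c s t f \<longleftrightarrow>
     (\<forall>e\<in>arcs G. 0 \<le> f e \<and> f e \<le> c e) \<and>
     (\<forall>v\<in>verts G - {s, t}. sum f (in_arcs G v) = sum f (out_arcs G v))"

definition flow_value :: "('a, 'b) pre_digraph \<Rightarrow> 'a \<Rightarrow> ('b \<Rightarrow> real) \<Rightarrow> real" where
  "flow_value G s f = sum f (out_arcs G s) - sum f (in_arcs G s)"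

definition is_max_flow ::
    "('a, 'b) pre_digraph \<Rightarrow> ('b \<Rightarrow> real) \<Rightarrow> 'a \<Rightarrow> 'a \<Rightarrow> ('b \<Rightarrow> real) \<Rightarrow> bool" where
  "is_max_flow G c s t f \<longleftrightarrow>
     is_flow G c s t f \<and> (\<forall>g. is_flow G c s t g \<longrightarrow> flow_value G s g \<le> flow_value G s f)"

type_synonym solver =
  "(nat, nat) pre_digraph \<Rightarrow> (nat \<Rightarrow> real) \<Rightarrow> nat \<Rightarrow> nat \<Rightarrow> (nat \<Rightarrow> real)"

text \<open>A solver may return any maximum flow, and anything at all outside flow networks.\<close>

definition max_flow_solver :: "solver \<Rightarrow> bool" where
  "max_flow_solver Opt \<longleftrightarrow>
     (\<forall>G c s t. flow_network G c s t \<longrightarrow> is_max_flow G c s t (Opt G c s t))"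

text \<open>Sanity check: solvers exist.\<close>

lemma max_flow_exists:
  assumes "flow_network G c s t"
  shows "\<exists>f. is_max_flow G c s t f"
proof -
  interpret fin_digraph G using assms by (simp add: flow_network_def)
  define B where "B = (\<lambda>e. {0..(if e \<in> arcs G then c e else 0)})"
  define S where "S = {f :: 'b \<Rightarrow> real. \<forall>v\<in>verts G - {s, t}. sum f (in_arcs G v) = sum f (out_arcs G v)}"
  have "compactin (product_topology (\<lambda>_. euclidean) UNIV) (PiE UNIV B)"
    unfolding compactin_PiE by (simp add: B_def)
  hence cB: "compact (PiE UNIV B)"
    by (simp add: euclidean_product_topology)
  have cont: "continuous_on X (\<lambda>f. sum f A)" for X :: "('b \<Rightarrow> real) set" and A
    by (intro continuous_on_sum) (rule continuous_on_product_coordinates[THEN continuous_on_subset], simp)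
  have "S = (\<Inter>v\<in>verts G - {s, t}. {f. sum f (in_arcs G v) = sum f (out_arcs G v)})"
    by (auto simp: S_def)
  moreover have "closed {f :: 'b \<Rightarrow> real. sum f (in_arcs G v) = sum f (out_arcs G v)}" for v
    by (intro closed_Collect_eq cont)
  ultimately have "closed S" by auto
  with cB have cK: "compact (PiE UNIV B \<inter> S)" by (rule compact_Int_closed)
  have "(\<lambda>_. 0) \<in> PiE UNIV B \<inter> S"
    using assms by (auto simp: B_def S_def flow_network_def less_imp_le)
  moreover have "continuous_on (PiE UNIV B \<inter> S) (flow_value G s)"
    unfolding flow_value_def
    by (intro continuous_on_diff cont)
  ultimately have "\<exists>f\<in>PiE UNIV B \<inter> S. \<forall>g\<in>PiE UNIV B \<inter> S. flow_value G s g \<le> flow_value G s f"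
    using cK by (intro continuous_attains_sup) (assumption, fast, assumption)
  then obtain f where f: "f \<in> PiE UNIV B \<inter> S"
    and max: "\<And>g. g \<in> PiE UNIV B \<inter> S \<Longrightarrow> flow_value G s g \<le> flow_value G s f"
    by (elim bexE) simp
  have maximal: "flow_value G s g \<le> flow_value G s f" if g: "is_flow G c s t g" for g
  proof -
    define h where "h = (\<lambda>e. if e \<in> arcs G then g e else 0)"
    have eq: "sum h (in_arcs G v) = sum g (in_arcs G v)" "sum h (out_arcs G v) = sum g (out_arcs G v)" for v
      by (auto intro!: sum.cong simp: h_def)
    have "h \<in> PiE UNIV B \<inter> S"
      using g unfolding S_def by (auto simp: eq is_flow_def) (auto simp: B_def h_def)
    from max[OF this] show ?thesis by (simp add: flow_value_def eq)
  qed
  have "f e \<in> B e" for e :: 'b using f by (simp add: PiE_iff)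
  hence "0 \<le> f e \<and> f e \<le> c e" if "e \<in> arcs G" for e
    using that unfolding B_def by (metis (full_types) atLeastAtMost_iff)
  with f have "is_flow G c s t f" by (simp add: is_flow_def S_def)
  with maximal show ?thesis by (auto simp: is_max_flow_def)
qed

lemma max_flow_solver_exists: "\<exists>Opt. max_flow_solver Opt"
proof -
  have "is_max_flow G c s t (SOME f. is_max_flow G c s t f)"
    if "flow_network G c s t" for G :: "(nat, nat) pre_digraph" and c s t
    using max_flow_exists[OF that] by (rule someI_ex)
  hence "max_flow_solver (\<lambda>G c s t. SOME f. is_max_flow G c s t f)"
    by (simp add: max_flow_solver_def)
  thus ?thesis by (intro exI)
qed


section \<open>Algorithms with a maximum-flow subroutine\<close>

text \<open>
  Algorithms are programs for a real RAM: a WHILE language with natural-number and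
  real scalars and arrays. Without some restriction on the work done outside the
  maximum-flow computations, every computable problem would be solvable with any number of
  them, so running times are counted. The primitive operations are kept weak for the same
  reason: the naturals have only addition and truncated subtraction, and there
  are no real constants other than 0 and 1, no rounding and no exponentiation.
\<close>

datatype iexp =
    IConst nat
  | IVar string
  | IArr string iexp
  | IAdd iexp iexp
  | ISub iexp iexp

datatype rexp =
    RZero
  | ROne
  | RVar string
  | RArr string iexp
  | RAdd rexp rexp
  | RSub rexp rexp
  | RMul rexp rexp
  | RDiv rexp rexp

datatype bexp =
    BILess iexp iexp
  | BRLess rexp rexp
  | BNot bexp
  | BAnd bexp bexp

text \<open>
  In \<open>MaxFlow n m ta ha c s t f\<close> the arguments \<open>n m s t\<close> are evaluated, \<open>ta ha c\<close> name the arrays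
  that hold the tails, heads and capacities of the arcs, and \<open>f\<close> names the array that
  receives the computed flow.
\<close>

datatype com =
    Skip
  | IAssign string iexp
  | IStore string iexp iexp
  | RAssign string rexp
  | RStore string iexp rexp
  | Seq com com
  | If bexp com com
  | While bexp com
  | MaxFlow iexp iexp string string string iexp iexp string

record store =
  ivar :: "string \<Rightarrow> nat"
  iarr :: "string \<Rightarrow> nat \<Rightarrow> nat"
  rvar :: "string \<Rightarrow> real"
  rarr :: "string \<Rightarrow> nat \<Rightarrow> real"

fun ival :: "iexp \<Rightarrow> store \<Rightarrow> nat" where
  "ival (IConst k) \<sigma> = k"
| "ival (IVar x) \<sigma> = ivar \<sigma> x"
| "ival (IArr a i) \<sigma> = iarr \<sigma> a (ival i \<sigma>)"
| "ival (IAdd i j) \<sigma> = ival i \<sigma> + ival j \<sigma>"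
| "ival (ISub i j) \<sigma> = ival i \<sigma> - ival j \<sigma>"

fun rval :: "rexp \<Rightarrow> store \<Rightarrow> real" where
  "rval RZero \<sigma> = 0"
| "rval ROne \<sigma> = 1"
| "rval (RVar x) \<sigma> = rvar \<sigma> x"
| "rval (RArr a i) \<sigma> = rarr \<sigma> a (ival i \<sigma>)"
| "rval (RAdd p q) \<sigma> = rval p \<sigma> + rval q \<sigma>"
| "rval (RSub p q) \<sigma> = rval p \<sigma> - rval q \<sigma>"
| "rval (RMul p q) \<sigma> = rval p \<sigma> * rval q \<sigma>"
| "rval (RDiv p q) \<sigma> = rval p \<sigma> / rval q \<sigma>"

fun bval :: "bexp \<Rightarrow> store \<Rightarrow> bool" where
  "bval (BILess i j) \<sigma> \<longleftrightarrow> ival i \<sigma> < ival j \<sigma>"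
| "bval (BRLess p q) \<sigma> \<longleftrightarrow> rval p \<sigma> < rval q \<sigma>"
| "bval (BNot b) \<sigma> \<longleftrightarrow> \<not> bval b \<sigma>"
| "bval (BAnd b b') \<sigma> \<longleftrightarrow> bval b \<sigma> \<and> bval b' \<sigma>"

text \<open>
  \<open>exec Opt p \<sigma> \<sigma>' T k\<close>: started in \<open>\<sigma>\<close>, the program \<open>p\<close> terminates in \<open>\<sigma>'\<close> after \<open>T\<close> steps, having
  performed \<open>k\<close> maximum-flow computations, each done by \<open>Opt\<close>. The expressions of a fixed program have
  bounded size, so evaluating one is part of a single step. A maximum-flow computation on \<open>n\<close>
  vertices and \<open>m\<close> arcs contributes \<open>1 + n + m\<close> steps, the cost of handing over the instance
  and receiving the flow; thus \<open>T\<close> also bounds the sizes of the instances solved.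
\<close>

inductive exec :: "solver \<Rightarrow> com \<Rightarrow> store \<Rightarrow> store \<Rightarrow> nat \<Rightarrow> nat \<Rightarrow> bool" for Opt where
  Skip: "exec Opt Skip \<sigma> \<sigma> 1 0"
| IAssign: "exec Opt (IAssign x i) \<sigma> (\<sigma>\<lparr>ivar := (ivar \<sigma>)(x := ival i \<sigma>)\<rparr>) 1 0"
| IStore: "exec Opt (IStore a i j) \<sigma>
    (\<sigma>\<lparr>iarr := (iarr \<sigma>)(a := (iarr \<sigma> a)(ival i \<sigma> := ival j \<sigma>))\<rparr>) 1 0"
| RAssign: "exec Opt (RAssign x q) \<sigma> (\<sigma>\<lparr>rvar := (rvar \<sigma>)(x := rval q \<sigma>)\<rparr>) 1 0"
| RStore: "exec Opt (RStore a i q) \<sigma>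
    (\<sigma>\<lparr>rarr := (rarr \<sigma>)(a := (rarr \<sigma> a)(ival i \<sigma> := rval q \<sigma>))\<rparr>) 1 0"
| Seq: "exec Opt p \<sigma> \<sigma>' T k \<Longrightarrow> exec Opt q \<sigma>' \<sigma>'' T' k' \<Longrightarrow>
    exec Opt (Seq p q) \<sigma> \<sigma>'' (T + T') (k + k')"
| IfTrue: "bval b \<sigma> \<Longrightarrow> exec Opt p \<sigma> \<sigma>' T k \<Longrightarrow> exec Opt (If b p q) \<sigma> \<sigma>' (1 + T) k"
| IfFalse: "\<not> bval b \<sigma> \<Longrightarrow> exec Opt q \<sigma> \<sigma>' T k \<Longrightarrow> exec Opt (If b p q) \<sigma> \<sigma>' (1 + T) k"
| WhileFalse: "\<not> bval b \<sigma> \<Longrightarrow> exec Opt (While b p) \<sigma> \<sigma> 1 0"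
| WhileTrue: "bval b \<sigma> \<Longrightarrow> exec Opt p \<sigma> \<sigma>' T k \<Longrightarrow> exec Opt (While b p) \<sigma>' \<sigma>'' T' k' \<Longrightarrow>
    exec Opt (While b p) \<sigma> \<sigma>'' (1 + T + T') (k + k')"
| MaxFlow: "n' = ival n \<sigma> \<Longrightarrow> m' = ival m \<sigma> \<Longrightarrow>
    g = Opt \<lparr>verts = {..<n'}, arcs = {..<m'}, tail = iarr \<sigma> ta, head = iarr \<sigma> ha\<rparr>
          (rarr \<sigma> c) (ival s \<sigma>) (ival t \<sigma>) \<Longrightarrow>
    exec Opt (MaxFlow n m ta ha c s t f) \<sigma>
      (\<sigma>\<lparr>rarr := (rarr \<sigma>)(f := (\<lambda>i. if i < m' then g i else rarr \<sigma> f i))\<rparr>) (1 + n' + m') 1"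

inductive_cases exec_elims:
  "exec Opt Skip \<sigma> \<sigma>' T k"
  "exec Opt (IAssign x i) \<sigma> \<sigma>' T k"
  "exec Opt (IStore a i j) \<sigma> \<sigma>' T k"
  "exec Opt (RAssign x q) \<sigma> \<sigma>' T k"
  "exec Opt (RStore a i q) \<sigma> \<sigma>' T k"
  "exec Opt (Seq p q) \<sigma> \<sigma>' T k"
  "exec Opt (If b p q) \<sigma> \<sigma>' T k"
  "exec Opt (While b p) \<sigma> \<sigma>' T k"
  "exec Opt (MaxFlow n m ta ha c s t f) \<sigma> \<sigma>' T k"

text \<open>Sanity check: an execution is determined by the program, the solver and the input.\<close>

lemma exec_deterministic:
  "exec Opt p \<sigma> \<sigma>1 T1 k1 \<Longrightarrow> exec Opt p \<sigma> \<sigma>2 T2 k2 \<Longrightarrow> \<sigma>2 = \<sigma>1 \<and> T2 = T1 \<and> k2 = k1"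
proof (induction arbitrary: \<sigma>2 T2 k2 rule: exec.induct)
  case (WhileTrue b \<sigma> p \<sigma>' T k \<sigma>'' T' k')
  from WhileTrue.prems show ?case
    by (rule exec_elims(8)) (use WhileTrue.hyps(1) in \<open>auto dest!: WhileTrue.IH\<close>)
next
  case (Seq p \<sigma> \<sigma>' T k q \<sigma>'' T' k')
  from Seq.prems show ?case
    by (rule exec_elims(6)) (auto dest!: Seq.IH)
next
  case (IfTrue b \<sigma> p \<sigma>' T k q)
  from IfTrue.prems show ?case
    by (rule exec_elims(7)) (use IfTrue.hyps(1) in \<open>auto dest!: IfTrue.IH\<close>)
next
  case (IfFalse b \<sigma> q \<sigma>' T k p)
  from IfFalse.prems show ?case
    by (rule exec_elims(7)) (use IfFalse.hyps(1) in \<open>auto dest!: IfFalse.IH\<close>)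
next
  case (WhileFalse b \<sigma> p)
  from WhileFalse.prems show ?case
    by (rule exec_elims(8)) (use WhileFalse.hyps(1) in \<open>simp_all\<close>)
next
  case MaxFlow
  from MaxFlow.prems show ?case
    unfolding MaxFlow.hyps by (rule exec_elims(9)) simp
qed (erule exec_elims(1-5), simp)+

text \<open>The input: vertices and arcs are numbered from 0; all other memory cells are 0.\<close>

definition input_store ::
    "nat \<Rightarrow> nat \<Rightarrow> (nat, nat) pre_digraph \<Rightarrow> (nat \<Rightarrow> real) \<Rightarrow> nat \<Rightarrow> nat \<Rightarrow> nat \<Rightarrow> store" where
  "input_store n m G c s t e =
     \<lparr>ivar = (\<lambda>_. 0)(''n'' := n, ''m'' := m, ''s'' := s, ''t'' := t, ''e'' := e),
      iarr = (\<lambda>_ _. 0)(''tail'' := (\<lambda>i. if i < m then tail G i else 0),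
                       ''head'' := (\<lambda>i. if i < m then head G i else 0)),
      rvar = (\<lambda>_. 0),
      rarr = (\<lambda>_ _. 0)(''cap'' := (\<lambda>i. if i < m then c i else 0))\<rparr>"

end

theory Submission
  imports Defs
begin

text \<open>
  Let \<open>f\<^sub>0\<close> be a maximum flow. The maximum flows are the \<open>f\<^sub>0 + d\<close> with \<open>d\<close> a circulation in the
  residual network. Detach the tail \<open>u\<close> of \<open>e\<close> and attach \<open>e\<close> to a new vertex \<open>n\<close> instead: then
  circulations become \<open>(n, u)\<close>-flows, and \<open>d e\<close> becomes the value of the flow. Hence a second maximum
  flow, from \<open>n\<close> to \<open>u\<close> in the residual network so modified, maximizes \<open>d e\<close>.
\<close>

section \<open>Net outflow\<close>

text \<open>Arcs are the numbers below \<open>m\<close> and the tails are a bare function, so the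
  tail of a single arc can be changed by \<open>fun_upd\<close>. The signed coefficient makes
  linearity in \<open>f\<close> immediate and lets a loop contribute 0.\<close>

definition net_out :: "nat \<Rightarrow> (nat \<Rightarrow> nat) \<Rightarrow> (nat \<Rightarrow> nat) \<Rightarrow> (nat \<Rightarrow> real) \<Rightarrow> nat \<Rightarrow> real" where
  "net_out m ta ha f v = (\<Sum>i<m. (of_bool (ta i = v) - of_bool (ha i = v)) * f i)"

lemma net_out_add:
  "net_out m ta ha (\<lambda>i. f i + g i) v = net_out m ta ha f v + net_out m ta ha g v"
  by (simp add: net_out_def ring_distribs sum.distrib)

lemma net_out_diff:
  "net_out m ta ha (\<lambda>i. f i - g i) v = net_out m ta ha f v - net_out m ta ha g v"
  by (simp add: net_out_def right_diff_distrib sum_subtractf)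

lemma net_out_cong:
  assumes "\<And>i. i < m \<Longrightarrow> ta i = ta' i" "\<And>i. i < m \<Longrightarrow> ha i = ha' i" "\<And>i. i < m \<Longrightarrow> f i = f' i"
  shows "net_out m ta ha f v = net_out m ta' ha' f' v"
  unfolding net_out_def using assms by (intro sum.cong) auto

text \<open>Swap the sums: arc \<open>i\<close> contributes \<open>f i\<close> at its tail and
  \<open>- f i\<close> at its head, and both ends lie below \<open>n\<close>.\<close>

lemma sum_net_out:
  assumes "\<And>i. i < m \<Longrightarrow> ta i < n \<and> ha i < n"
  shows "(\<Sum>v<n. net_out m ta ha f v) = 0"
proof -
  have "(\<Sum>v<n. (of_bool (ta i = v) - of_bool (ha i = v)) * f i) = 0" if "i < m" for i
    using assms[OF that] by (simp add: sum_distrib_right[symmetric] sum_subtractf of_bool_def)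
  then show ?thesis
    unfolding net_out_def by (subst sum.swap) simp
qed

text \<open>All net outflows sum to 0, so conservation at every vertex but one forces it at the
  last. The exceptional vertex will be the old tail of \<open>e\<close> in one use and the sink
  \<open>t\<close> in the other.\<close>

lemma net_out_eq_0_all:
  assumes "\<And>i. i < m \<Longrightarrow> ta i < n \<and> ha i < n" "u < n"
    and "\<And>v. v < n \<Longrightarrow> v \<noteq> u \<Longrightarrow> net_out m ta ha f v = 0"
    and "v < n"
  shows "net_out m ta ha f v = 0"
proof -
  have "0 = (\<Sum>v<n. net_out m ta ha f v)"
    using assms(1) by (simp add: sum_net_out)
  also have "\<dots> = (\<Sum>v\<in>{u}. net_out m ta ha f v)"
    using assms(2,3) by (intro sum.mono_neutral_right) auto
  finally show ?thesis using assms(3,4) by (cases "v = u") auto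
qed

text \<open>No other arc touches \<open>n\<close>, so the net outflow there is the flow on
  \<open>e\<close> alone; this turns the flow on an arc into the value of a flow. At the old
  vertices only the contribution of \<open>e\<close> to its former tail is lost.\<close>

lemma net_out_new_tail:
  assumes "\<And>i. i < m \<Longrightarrow> ta i < n \<and> ha i < n" "e < m"
  shows "net_out m (ta(e := n)) ha f n = f e"
    and "v < n \<Longrightarrow> net_out m (ta(e := n)) ha f v = net_out m ta ha f v - of_bool (v = ta e) * f e"
proof -
  have "net_out m (ta(e := n)) ha f n = (\<Sum>i<m. if i = e then f i else 0)"
    unfolding net_out_def using assms(1) by (intro sum.cong) (auto dest: less_imp_neq)
  then show "net_out m (ta(e := n)) ha f n = f e"
    using assms(2) by simp
  assume v: "v < n"
  have "net_out m (ta(e := n)) ha f v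
      = (\<Sum>i<m. (of_bool (ta i = v) - of_bool (ha i = v)) * f i
                - (if i = e then of_bool (v = ta e) * f e else 0))"
    unfolding net_out_def using v by (intro sum.cong) auto
  then show "net_out m (ta(e := n)) ha f v = net_out m ta ha f v - of_bool (v = ta e) * f e"
    using assms(2) by (simp add: net_out_def sum_subtractf)
qed

section \<open>Flows and maximum flows in terms of net outflow\<close>

text \<open>Here \<open>v\<close> is arbitrary and not only the source: conservation at
  \<open>v\<close> says that \<open>flow_value G v f\<close> is 0, which is how
  \<open>is_flow_net_out\<close> uses this.\<close>

lemma flow_value_net_out:
  assumes "arcs G = {..<m}"
  shows "flow_value G v f = net_out m (tail G) (head G) f v"
proof -
  have "out_arcs G v = {i \<in> {..<m}. tail G i = v}" "in_arcs G v = {i \<in> {..<m}. head G i = v}"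
    unfolding assms[symmetric] by auto
  moreover have "sum f {i \<in> {..<m}. h i = v} = (\<Sum>i<m. of_bool (h i = v) * f i)" for h :: "nat \<Rightarrow> nat"
    unfolding sum.inter_filter[OF finite_lessThan] by (rule sum.cong) auto
  ultimately show ?thesis
    unfolding flow_value_def net_out_def by (simp add: left_diff_distrib sum_subtractf)
qed

lemma is_flow_net_out:
  fixes G :: "(nat, nat) pre_digraph"
  assumes "verts G = {..<n}" "arcs G = {..<m}"
  shows "is_flow G c s t f \<longleftrightarrow> (\<forall>i<m. 0 \<le> f i \<and> f i \<le> c i) \<and>
    (\<forall>v<n. v \<noteq> s \<longrightarrow> v \<noteq> t \<longrightarrow> net_out m (tail G) (head G) f v = 0)"
  unfolding is_flow_def assms flow_value_net_out[OF assms(2), symmetric] flow_value_def by auto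

text \<open>The arrays in memory are tied to the digraph only at indices below \<open>m\<close>;
  this transfers maximality between the stored instance and \<open>G\<close>.\<close>

lemma is_max_flow_cong:
  fixes G G' :: "(nat, nat) pre_digraph"
  assumes "verts G = {..<n}" "arcs G = {..<m}" "verts G' = {..<n}" "arcs G' = {..<m}"
    and "\<And>i. i < m \<Longrightarrow> tail G i = tail G' i" "\<And>i. i < m \<Longrightarrow> head G i = head G' i"
    and "\<And>i. i < m \<Longrightarrow> c i = c' i" "\<And>i. i < m \<Longrightarrow> f i = f' i"
  shows "is_max_flow G c s t f \<longleftrightarrow> is_max_flow G' c' s t f'"
proof -
  have net: "net_out m (tail G) (head G) g v = net_out m (tail G') (head G') g v" for g v
    using assms by (intro net_out_cong) auto
  have netf: "net_out m (tail G') (head G') f v = net_out m (tail G') (head G') f' v" for v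
    using assms by (intro net_out_cong) auto
  show ?thesis
    using assms(7,8)
    by (simp add: is_max_flow_def is_flow_net_out[OF assms(1,2)] is_flow_net_out[OF assms(3,4)]
        flow_value_net_out[OF assms(2)] flow_value_net_out[OF assms(4)] net netf)
qed

lemma flow_networkI:
  fixes n m :: nat
  assumes "\<And>i. i < m \<Longrightarrow> ta i < n \<and> ha i < n \<and> 0 < c i" "s < n" "t < n" "s \<noteq> t"
  shows "flow_network \<lparr>verts = {..<n}, arcs = {..<m}, tail = ta, head = ha\<rparr> c s t"
  unfolding flow_network_def using assms by (auto intro!: fin_digraph.intro wf_digraph.intro
      simp: fin_digraph_axioms_def)

lemma flow_network_ends_less:
  fixes G :: "(nat, nat) pre_digraph"
  assumes "flow_network G c s t" "verts G = {..<n}" "arcs G = {..<m}" "i < m"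
  shows "tail G i < n \<and> head G i < n"
proof -
  interpret fin_digraph G using assms by (simp add: flow_network_def)
  show ?thesis using wellformed[of i] assms by auto
qed


section \<open>Residual networks\<close>

text \<open>
  Networks have positive capacities. Instead of leaving out an arc without residual capacity, which
  would require renumbering, it is replaced by a loop with weight 0.
\<close>

definition residual_arc ::
    "(nat \<Rightarrow> nat) \<Rightarrow> (nat \<Rightarrow> nat) \<Rightarrow> (nat \<Rightarrow> real) \<Rightarrow> (nat \<Rightarrow> real) \<Rightarrow> nat \<Rightarrow>
      nat \<Rightarrow> nat \<Rightarrow> real \<Rightarrow> bool" where
  "residual_arc ta ha c w k x y r \<longleftrightarrow>
     (if 0 < r then ta k = x \<and> ha k = y \<and> c k = r \<and> w k = 1
      else ta k = 0 \<and> ha k = 0 \<and> c k = 1 \<and> w k = 0)"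

text \<open>A genuine arc has weight 1 and a placeholder weight 0, so \<open>w k * g\<close> is the
  amount that counts. A placeholder drops out of the balance on the left as a loop and on the right
  by its weight.\<close>

lemma residual_arc_weight:
  assumes "residual_arc ta ha c w k x y r" "0 \<le> r" "0 \<le> g" "g \<le> c k"
  shows "0 \<le> w k * g" "w k * g \<le> r"
    "(of_bool (ta k = v) - of_bool (ha k = v)) * g
      = (of_bool (x = v) - of_bool (y = v)) * (w k * g)"
  using assms by (auto simp: residual_arc_def split: if_splits)

lemma sum_lessThan_double:
  "(\<Sum>i<m + m. h i) = (\<Sum>i<m. h i + h (m + i))" for h :: "nat \<Rightarrow> real"
proof -
  have "(\<Sum>i<m + m. h i) = (\<Sum>i<m. h i) + (\<Sum>i\<in>{m..<m + m}. h i)"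
    by (subst sum.union_disjoint[symmetric]) (auto intro!: sum.cong)
  also have "(\<Sum>i\<in>{m..<m + m}. h i) = (\<Sum>i<m. h (m + i))"
    using sum.shift_bounds_nat_ivl[of h 0 m m] by (simp add: lessThan_atLeast0 add.commute)
  finally show ?thesis by (simp add: sum.distrib)
qed

text \<open>Slots \<open>i\<close> and \<open>m + i\<close> carry the increase and the decrease on
  arc \<open>i\<close>. Every flow in \<open>H\<close> thus gives a change within the bounds, and
  the positive and negative parts of a change give a flow back, so optimality carries over.
  \<open>ta\<close> is kept general because it will be applied with the tail of \<open>e\<close>
  moved.\<close>

lemma residual_max_flow:
  fixes ta ha :: "nat \<Rightarrow> nat" and lo hi :: "nat \<Rightarrow> real"
  assumes H: "verts H = {..<n :: nat}" "arcs H = {..<m + m}"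
    and fwd: "\<And>i. i < m \<Longrightarrow> residual_arc (tail H) (head H) c w i (ta i) (ha i) (hi i)"
    and bwd: "\<And>i. i < m \<Longrightarrow> residual_arc (tail H) (head H) c w (m + i) (ha i) (ta i) (lo i)"
    and nonneg: "\<And>i. i < m \<Longrightarrow> 0 \<le> lo i \<and> 0 \<le> hi i"
    and max: "is_max_flow H c s t g"
  defines "d \<equiv> \<lambda>i. w i * g i - w (m + i) * g (m + i)"
  shows "i < m \<Longrightarrow> - lo i \<le> d i \<and> d i \<le> hi i"
    and "v < n \<Longrightarrow> v \<noteq> s \<Longrightarrow> v \<noteq> t \<Longrightarrow> net_out m ta ha d v = 0"
    and "\<And>d'. (\<And>i. i < m \<Longrightarrow> - lo i \<le> d' i \<and> d' i \<le> hi i) \<Longrightarrow>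
      (\<And>v. v < n \<Longrightarrow> v \<noteq> s \<Longrightarrow> v \<noteq> t \<Longrightarrow> net_out m ta ha d' v = 0) \<Longrightarrow>
      net_out m ta ha d' s \<le> net_out m ta ha d s"
proof -
  have flow: "is_flow H c s t g"
    using max by (simp add: is_max_flow_def)
  then have g: "0 \<le> g k \<and> g k \<le> c k" if "k < m + m" for k
    using that H by (simp add: is_flow_def)
  \<comment> \<open>Proved for every \<open>h\<close> within the capacities: it serves both the
    maximum flow \<open>g\<close> and the flow built from a competitor \<open>d'\<close>.\<close>
  have net: "net_out (m + m) (tail H) (head H) h v
      = net_out m ta ha (\<lambda>i. w i * h i - w (m + i) * h (m + i)) v"
    if h: "\<And>k. k < m + m \<Longrightarrow> 0 \<le> h k \<and> h k \<le> c k" for h v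
    unfolding net_out_def sum_lessThan_double
  proof (rule sum.cong)
    fix i assume "i \<in> {..<m}"
    then have i: "i < m" by simp
    show "(of_bool (tail H i = v) - of_bool (head H i = v)) * h i
        + (of_bool (tail H (m + i) = v) - of_bool (head H (m + i) = v)) * h (m + i)
      = (of_bool (ta i = v) - of_bool (ha i = v)) * (w i * h i - w (m + i) * h (m + i))"
      using residual_arc_weight(3)[OF fwd[OF i], of "h i" v]
        residual_arc_weight(3)[OF bwd[OF i], of "h (m + i)" v] nonneg[OF i] h[of i] h[of "m + i"] i
      by (simp add: algebra_simps)
  qed simp
  show "- lo i \<le> d i \<and> d i \<le> hi i" if i: "i < m"
    using residual_arc_weight(1,2)[OF fwd[OF i], of "g i"]
      residual_arc_weight(1,2)[OF bwd[OF i], of "g (m + i)"] nonneg[OF i] g[of i] g[of "m + i"] i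
    by (simp add: d_def)
  show "net_out m ta ha d v = 0" if "v < n" "v \<noteq> s" "v \<noteq> t"
    using flow that net[OF g] by (simp add: is_flow_net_out[OF H] d_def)
  fix d' assume bounds: "\<And>i. i < m \<Longrightarrow> - lo i \<le> d' i \<and> d' i \<le> hi i"
    and cons: "\<And>v. v < n \<Longrightarrow> v \<noteq> s \<Longrightarrow> v \<noteq> t \<Longrightarrow> net_out m ta ha d' v = 0"
  \<comment> \<open>Positive part in slot \<open>k\<close>, negative part in slot
    \<open>m + k\<close>. A placeholder receives 0, since its residual capacity is 0 and the bounds
    then exclude a part of that sign; hence the weights lose nothing.\<close>
  define h where "h = (\<lambda>k. if k < m then max (d' k) 0 else max (- d' (k - m)) 0)"
  have h: "0 \<le> h k \<and> h k \<le> c k" if "k < m + m" for k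
  proof (cases "k < m")
    case True
    then show ?thesis
      using bounds[OF True] fwd[OF True] by (auto simp: h_def residual_arc_def split: if_splits)
  next
    case False
    define i where "i = k - m"
    have i: "i < m" "k = m + i" using False that by (auto simp: i_def)
    show ?thesis
      using bounds[OF i(1)] bwd[OF i(1)] by (auto simp: h_def i(2) residual_arc_def split: if_splits)
  qed
  have d': "w i * h i - w (m + i) * h (m + i) = d' i" if "i < m" for i
    using bounds[OF that] fwd[OF that] bwd[OF that] that
    by (auto simp: h_def residual_arc_def max_def split: if_splits)
  have net': "net_out (m + m) (tail H) (head H) h v = net_out m ta ha d' v" for v
    by (rule trans[OF net[OF h]]) (auto simp: d' intro!: net_out_cong)
  have "is_flow H c s t h"
    using h cons by (simp add: is_flow_net_out[OF H] net')
  then have "flow_value H s h \<le> flow_value H s g"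
    using max by (simp add: is_max_flow_def)
  then show "net_out m ta ha d' s \<le> net_out m ta ha d s"
    by (simp add: flow_value_net_out[OF H(2)] net' net[OF g] d_def)
qed

section \<open>Maximizing the flow on one arc\<close>

text \<open>The residual capacities are exactly the room that \<open>f\<close> leaves, so adding the
  change keeps the flow within \<open>c\<close>. The change is balanced at \<open>s\<close> and
  \<open>t\<close> as well, so the value of \<open>f\<close> is kept.\<close>

lemma max_flow_improve_arc:
  assumes N: "flow_network G c s t" and G: "verts G = {..<n}" "arcs G = {..<m}" and e: "e < m"
    and f: "is_max_flow G c s t f"
    and H: "verts H = {..<Suc n}" "arcs H = {..<m + m}"
    and fwd: "\<And>i. i < m \<Longrightarrow> residual_arc (tail H) (head H) b w i
      (((tail G)(e := n)) i) (head G i) (c i - f i)"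
    and bwd: "\<And>i. i < m \<Longrightarrow> residual_arc (tail H) (head H) b w (m + i)
      (head G i) (((tail G)(e := n)) i) (f i)"
    and g: "is_max_flow H b n (tail G e) g"
  defines "f1 \<equiv> \<lambda>i. f i + (w i * g i - w (m + i) * g (m + i))"
  shows "is_max_flow G c s t f1 \<and> (\<forall>f'. is_max_flow G c s t f' \<longrightarrow> f' e \<le> f1 e)"
proof -
  let ?net = "net_out m (tail G) (head G)"
  let ?net' = "net_out m ((tail G)(e := n)) (head G)"
  define d where "d = (\<lambda>i. w i * g i - w (m + i) * g (m + i))"
  have f1: "f1 = (\<lambda>i. f i + d i)" by (simp add: f1_def d_def)
  note ends = flow_network_ends_less[OF N G]
  note flow_iff = is_flow_net_out[OF G]
  have new: "?net' h n = h e"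
    "v < n \<Longrightarrow> ?net' h v = ?net h v - of_bool (v = tail G e) * h e" for h v
    using net_out_new_tail[of m "tail G" n "head G", OF _ e] ends by blast+
  have st: "s < n" "t < n" "s \<noteq> t"
    using N G by (auto simp: flow_network_def)
  have nonneg: "0 \<le> f i \<and> 0 \<le> c i - f i" if "i < m" for i
    using f that by (simp add: is_max_flow_def flow_iff)
  note res = residual_max_flow[OF H fwd bwd nonneg g, folded d_def]
  \<comment> \<open>Moving \<open>e\<close> back affects the balance of old vertices only at
    \<open>tail G e\<close>, and there the balance follows from the others.\<close>
  have circ: "?net d v = 0" if "v < n" for v
  proof (rule net_out_eq_0_all[OF ends _ _ that])
    show "tail G e < n" using ends[OF e] by simp
    fix x assume "x < n" "x \<noteq> tail G e"
    then have "?net' d x = 0" by (intro res(2)) auto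
    then show "?net d x = 0" using \<open>x < n\<close> \<open>x \<noteq> tail G e\<close> by (simp add: new(2) del: fun_upd_apply)
  qed
  have same_value: "flow_value G s f1 = flow_value G s f"
    using circ[OF st(1)] by (simp add: flow_value_net_out[OF G(2)] f1 net_out_add)
  have "is_flow G c s t f1"
    unfolding flow_iff
  proof (intro conjI allI impI)
    fix i assume "i < m"
    then show "0 \<le> f1 i" "f1 i \<le> c i" using res(1)[of i] by (simp_all add: f1 d_def)
  next
    fix v assume "v < n" "v \<noteq> s" "v \<noteq> t"
    then show "?net f1 v = 0"
      using f circ[of v] by (simp add: is_max_flow_def flow_iff f1 net_out_add)
  qed
  with f same_value have "is_max_flow G c s t f1" by (simp add: is_max_flow_def)
  moreover have "f' e \<le> f1 e" if f': "is_max_flow G c s t f'" for f'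
  proof -
    define d' where "d' = (\<lambda>i. f' i - f i)"
    have "flow_value G s f' = flow_value G s f"
      using f f' by (auto simp: is_max_flow_def intro: antisym)
    then have s0: "?net d' s = 0"
      by (simp add: flow_value_net_out[OF G(2)] d'_def net_out_diff)
    \<comment> \<open>The difference of two maximum flows is balanced at \<open>s\<close> by
      equality of values and at inner vertices by conservation, hence also at
      \<open>t\<close>.\<close>
    have circ': "?net d' v = 0" if "v < n" for v
    proof (rule net_out_eq_0_all[OF ends st(2) _ that])
      fix x assume "x < n" "x \<noteq> t"
      then show "?net d' x = 0"
        using f f' s0
        by (cases "x = s") (auto simp: is_max_flow_def flow_iff d'_def net_out_diff)
    qed
    \<comment> \<open>A competitor thus yields an admissible change of the modified network, whose
      value at \<open>n\<close> is \<open>f' e - f e\<close>.\<close>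
    have "?net' d' n \<le> ?net' d n"
    proof (rule res(3))
      fix i assume "i < m"
      then show "- f i \<le> d' i \<and> d' i \<le> c i - f i"
        using f' by (simp add: is_max_flow_def flow_iff d'_def)
    next
      fix v assume "v < Suc n" "v \<noteq> n" "v \<noteq> tail G e"
      then show "?net' d' v = 0" using new(2)[of v d'] circ'[of v] by simp
    qed
    then show ?thesis by (simp only: new(1)) (simp add: d'_def f1)
  qed
  ultimately show ?thesis by blast
qed


section \<open>Total correctness with step counts\<close>

text \<open>Steps are only bounded by \<open>B\<close>, whereas the number \<open>k\<close> of
  maximum-flow computations is exact. As executions are deterministic, existence amounts to total
  correctness.\<close>

definition runs :: "solver \<Rightarrow> com \<Rightarrow> store \<Rightarrow> nat \<Rightarrow> nat \<Rightarrow> (store \<Rightarrow> bool) \<Rightarrow> bool" where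
  "runs Opt p \<sigma> B k Q \<longleftrightarrow> (\<exists>\<sigma>' T. exec Opt p \<sigma> \<sigma>' T k \<and> T \<le> B \<and> Q \<sigma>')"

lemma runs_IAssign:
  "Q (\<sigma>\<lparr>ivar := (ivar \<sigma>)(x := ival i \<sigma>)\<rparr>) \<Longrightarrow> runs Opt (IAssign x i) \<sigma> 1 0 Q"
  unfolding runs_def by (blast intro: exec.IAssign)

lemma runs_IStore:
  "Q (\<sigma>\<lparr>iarr := (iarr \<sigma>)(a := (iarr \<sigma> a)(ival i \<sigma> := ival j \<sigma>))\<rparr>) \<Longrightarrow>
    runs Opt (IStore a i j) \<sigma> 1 0 Q"
  unfolding runs_def by (blast intro: exec.IStore)

lemma runs_RStore:
  "Q (\<sigma>\<lparr>rarr := (rarr \<sigma>)(a := (rarr \<sigma> a)(ival i \<sigma> := rval q \<sigma>))\<rparr>) \<Longrightarrow>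
    runs Opt (RStore a i q) \<sigma> 1 0 Q"
  unfolding runs_def by (blast intro: exec.RStore)

text \<open>The run of \<open>q\<close> is the postcondition of \<open>p\<close>, so repeated use
  executes a program symbolically from the front.\<close>

lemma runs_Seq:
  "runs Opt p \<sigma> B k (\<lambda>\<sigma>'. runs Opt q \<sigma>' B' k' Q) \<Longrightarrow> runs Opt (Seq p q) \<sigma> (B + B') (k + k') Q"
  unfolding runs_def by (blast intro: exec.Seq add_mono)

lemma runs_If:
  assumes "bval b \<sigma> \<Longrightarrow> runs Opt p \<sigma> B k Q" "\<not> bval b \<sigma> \<Longrightarrow> runs Opt q \<sigma> B k Q"
  shows "runs Opt (If b p q) \<sigma> (1 + B) k Q"
  using assms unfolding runs_def
  by (cases "bval b \<sigma>") (blast intro: exec.IfTrue exec.IfFalse add_left_mono)+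

text \<open>The answer of the solver enters as a variable \<open>g\<close> with an equation, which
  keeps the later stores small.\<close>

lemma runs_MaxFlow:
  assumes "ival n \<sigma> = n'" "ival m \<sigma> = m'"
    and "\<And>g. g = Opt \<lparr>verts = {..<n'}, arcs = {..<m'}, tail = iarr \<sigma> ta, head = iarr \<sigma> ha\<rparr>
          (rarr \<sigma> c) (ival s \<sigma>) (ival t \<sigma>) \<Longrightarrow>
      Q (\<sigma>\<lparr>rarr := (rarr \<sigma>)(f := (\<lambda>i. if i < m' then g i else rarr \<sigma> f i))\<rparr>)"
  shows "runs Opt (MaxFlow n m ta ha c s t f) \<sigma> (1 + n' + m') 1 Q"
  unfolding runs_def
  using exec.MaxFlow[OF assms(1)[symmetric] assms(2)[symmetric] refl] assms(3)[OF refl] by blast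

lemma runs_mono:
  assumes "runs Opt p \<sigma> B k Q" "B \<le> B'" "k = k'" "\<And>\<sigma>'. Q \<sigma>' \<Longrightarrow> Q' \<sigma>'"
  shows "runs Opt p \<sigma> B' k' Q'"
  using assms unfolding runs_def by (meson order_trans)

text \<open>\<open>I j\<close> describes the store after \<open>j\<close> rounds. Each round costs
  one test and at most \<open>B\<close> steps; the leading 1 is the final failing test.\<close>

lemma runs_While:
  assumes body: "\<And>j \<sigma>. j < N \<Longrightarrow> I j \<sigma> \<Longrightarrow> runs Opt p \<sigma> B 0 (I (Suc j))"
    and guard: "\<And>j \<sigma>. I j \<sigma> \<Longrightarrow> bval b \<sigma> \<longleftrightarrow> j < N"
    and "I 0 \<sigma>"
  shows "runs Opt (While b p) \<sigma> (1 + N * (1 + B)) 0 (I N)"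
proof -
  \<comment> \<open>Generalized to a start after \<open>j\<close> rounds, by induction downwards
    from \<open>N\<close>.\<close>
  have "runs Opt (While b p) \<sigma> (1 + (N - j) * (1 + B)) 0 (I N)" if "j \<le> N" "I j \<sigma>" for j \<sigma>
    using that
  proof (induction j arbitrary: \<sigma> rule: inc_induct)
    case base
    then show ?case
      using guard unfolding runs_def by (force intro: exec.WhileFalse)
  next
    case (step j)
    obtain \<sigma>' T where 1: "exec Opt p \<sigma> \<sigma>' T 0" "T \<le> B" "I (Suc j) \<sigma>'"
      using body[of j \<sigma>] step.hyps step.prems by (auto simp: runs_def)
    obtain \<sigma>'' T' where 2: "exec Opt (While b p) \<sigma>' \<sigma>'' T' 0"
        "T' \<le> 1 + (N - Suc j) * (1 + B)" "I N \<sigma>''"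
      using step.IH[OF 1(3)] by (auto simp: runs_def)
    have "exec Opt (While b p) \<sigma> \<sigma>'' (1 + T + T') (0 + 0)"
      using exec.WhileTrue[OF _ 1(1) 2(1)] guard step by blast
    moreover have "N - j = Suc (N - Suc j)" using step.hyps by simp
    then have "1 + T + T' \<le> 1 + (N - j) * (1 + B)" using 1(2) 2(2) by simp
    ultimately show ?case using 2(3) by (auto simp: runs_def)
  qed
  from this[of 0] assms(3) show ?thesis by simp
qed


section \<open>The algorithm\<close>

definition store_residual_arc :: "iexp \<Rightarrow> iexp \<Rightarrow> iexp \<Rightarrow> rexp \<Rightarrow> com" where
  "store_residual_arc k x y r =
     If (BRLess RZero r)
       (Seq (IStore ''rtail'' k x) (Seq (IStore ''rhead'' k y)
         (Seq (RStore ''rcap'' k r) (RStore ''w'' k ROne))))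
       (Seq (IStore ''rtail'' k (IConst 0)) (Seq (IStore ''rhead'' k (IConst 0))
         (Seq (RStore ''rcap'' k ROne) (RStore ''w'' k RZero))))"

text \<open>The counter starts at 0 because the input store sets it so.\<close>

definition residual_loop :: com where
  "residual_loop = While (BILess (IVar ''i'') (IVar ''m''))
     (Seq (store_residual_arc (IVar ''i'') (IArr ''tail'' (IVar ''i'')) (IArr ''head'' (IVar ''i''))
            (RSub (RArr ''cap'' (IVar ''i'')) (RArr ''f'' (IVar ''i''))))
     (Seq (store_residual_arc (IAdd (IVar ''m'') (IVar ''i''))
            (IArr ''head'' (IVar ''i'')) (IArr ''tail'' (IVar ''i'')) (RArr ''f'' (IVar ''i'')))
       (IAssign ''i'' (IAdd (IVar ''i'') (IConst 1)))))"

definition update_loop :: com where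
  "update_loop = While (BILess (IVar ''i'') (IVar ''m''))
     (Seq (RStore ''flow'' (IVar ''i'')
            (RAdd (RArr ''f'' (IVar ''i''))
              (RSub (RMul (RArr ''w'' (IVar ''i'')) (RArr ''g'' (IVar ''i'')))
                    (RMul (RArr ''w'' (IAdd (IVar ''m'') (IVar ''i'')))
                          (RArr ''g'' (IAdd (IVar ''m'') (IVar ''i'')))))))
       (IAssign ''i'' (IAdd (IVar ''i'') (IConst 1))))"

text \<open>The old tail is saved in \<open>''u''\<close> before \<open>''tail''\<close> is
  overwritten in place, so \<open>residual_loop\<close> builds the modified network without treating
  \<open>e\<close> separately.\<close>

definition max_arc_flow :: com where
  "max_arc_flow =
     Seq (MaxFlow (IVar ''n'') (IVar ''m'') ''tail'' ''head'' ''cap'' (IVar ''s'') (IVar ''t'') ''f'')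
     (Seq (IAssign ''u'' (IArr ''tail'' (IVar ''e'')))
     (Seq (IStore ''tail'' (IVar ''e'') (IVar ''n''))
     (Seq residual_loop
     (Seq (MaxFlow (IAdd (IVar ''n'') (IConst 1)) (IAdd (IVar ''m'') (IVar ''m''))
            ''rtail'' ''rhead'' ''rcap'' (IVar ''n'') (IVar ''u'') ''g'')
     (Seq (IAssign ''i'' (IConst 0))
       update_loop)))))"

section \<open>Correctness of the program pieces\<close>

definition residual_frame :: "store \<Rightarrow> store \<Rightarrow> bool" where
  "residual_frame \<sigma> \<sigma>' \<longleftrightarrow> ivar \<sigma>' = ivar \<sigma> \<and>
     (\<forall>a. a \<noteq> ''rtail'' \<longrightarrow> a \<noteq> ''rhead'' \<longrightarrow> iarr \<sigma>' a = iarr \<sigma> a) \<and>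
     (\<forall>a. a \<noteq> ''rcap'' \<longrightarrow> a \<noteq> ''w'' \<longrightarrow> rarr \<sigma>' a = rarr \<sigma> a)"

definition stored_residual_arc :: "store \<Rightarrow> nat \<Rightarrow> nat \<Rightarrow> nat \<Rightarrow> real \<Rightarrow> bool" where
  "stored_residual_arc \<sigma> =
     residual_arc (iarr \<sigma> ''rtail'') (iarr \<sigma> ''rhead'') (rarr \<sigma> ''rcap'') (rarr \<sigma> ''w'')"

text \<open>By \<open>args\<close> the expressions may be evaluated in the initial store although
  writes intervene. The bound 5 is one test and four writes.\<close>

lemma runs_store_residual_arc:
  assumes args: "\<And>\<sigma>'. residual_frame \<sigma> \<sigma>' \<Longrightarrow>
      ival k \<sigma>' = ival k \<sigma> \<and> ival x \<sigma>' = ival x \<sigma> \<and> ival y \<sigma>' = ival y \<sigma> \<and> rval r \<sigma>' = rval r \<sigma>"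
    and Q: "\<And>\<sigma>'. \<lbrakk>residual_frame \<sigma> \<sigma>';
      stored_residual_arc \<sigma>' (ival k \<sigma>) (ival x \<sigma>) (ival y \<sigma>) (rval r \<sigma>);
      \<And>l. l \<noteq> ival k \<sigma> \<Longrightarrow> stored_residual_arc \<sigma>' l = stored_residual_arc \<sigma> l\<rbrakk> \<Longrightarrow> Q \<sigma>'"
  shows "runs Opt (store_residual_arc k x y r) \<sigma> 5 0 Q"
proof -
  \<comment> \<open>The final store of either branch, with the written values as parameters;
    \<sigma>1, \<sigma>2 and \<sigma>3 below are the stores in between.\<close>
  define written where "written = (\<lambda>a b p q.
    \<sigma>\<lparr>iarr := (iarr \<sigma>)(''rtail'' := (iarr \<sigma> ''rtail'')(ival k \<sigma> := a),
                       ''rhead'' := (iarr \<sigma> ''rhead'')(ival k \<sigma> := b)),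
      rarr := (rarr \<sigma>)(''rcap'' := (rarr \<sigma> ''rcap'')(ival k \<sigma> := p),
                       ''w'' := (rarr \<sigma> ''w'')(ival k \<sigma> := q))\<rparr>)"
  have Q': "Q (written a b p q)"
    if "if 0 < rval r \<sigma> then a = ival x \<sigma> \<and> b = ival y \<sigma> \<and> p = rval r \<sigma> \<and> q = 1
        else a = 0 \<and> b = 0 \<and> p = 1 \<and> q = 0" for a b p q
    using that
    by (intro Q) (auto simp: written_def residual_frame_def stored_residual_arc_def residual_arc_def
        fun_eq_iff split: if_splits)
  define \<sigma>1 where "\<sigma>1 a = \<sigma>\<lparr>iarr := (iarr \<sigma>)(''rtail'' := (iarr \<sigma> ''rtail'')(ival k \<sigma> := a))\<rparr>" for a
  define \<sigma>2 where "\<sigma>2 a b =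
    \<sigma>\<lparr>iarr := (iarr \<sigma>)(''rtail'' := (iarr \<sigma> ''rtail'')(ival k \<sigma> := a),
                       ''rhead'' := (iarr \<sigma> ''rhead'')(ival k \<sigma> := b))\<rparr>" for a b
  define \<sigma>3 where "\<sigma>3 a b p =
    \<sigma>\<lparr>iarr := (iarr \<sigma>)(''rtail'' := (iarr \<sigma> ''rtail'')(ival k \<sigma> := a),
                       ''rhead'' := (iarr \<sigma> ''rhead'')(ival k \<sigma> := b)),
      rarr := (rarr \<sigma>)(''rcap'' := (rarr \<sigma> ''rcap'')(ival k \<sigma> := p))\<rparr>" for a b p
  have "residual_frame \<sigma> (\<sigma>1 a)" "residual_frame \<sigma> (\<sigma>2 a b)" "residual_frame \<sigma> (\<sigma>3 a b p)" for a b p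
    by (auto simp: residual_frame_def \<sigma>1_def \<sigma>2_def \<sigma>3_def)
  note args' = this[THEN args, unfolded \<sigma>1_def \<sigma>2_def \<sigma>3_def]
  show ?thesis
    unfolding store_residual_arc_def
  proof (rule runs_mono[where Q = Q, OF runs_If])
    assume "bval (BRLess RZero r) \<sigma>"
    then show "runs Opt (Seq (IStore ''rtail'' k x) (Seq (IStore ''rhead'' k y)
        (Seq (RStore ''rcap'' k r) (RStore ''w'' k ROne)))) \<sigma> (1 + (1 + (1 + 1))) (0 + (0 + (0 + 0))) Q"
      by (intro runs_Seq runs_IStore runs_RStore) (simp add: args' Q'[unfolded written_def])
  next
    assume "\<not> bval (BRLess RZero r) \<sigma>"
    then show "runs Opt (Seq (IStore ''rtail'' k (IConst 0)) (Seq (IStore ''rhead'' k (IConst 0))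
        (Seq (RStore ''rcap'' k ROne) (RStore ''w'' k RZero)))) \<sigma> (1 + (1 + (1 + 1))) (0 + (0 + (0 + 0))) Q"
      by (intro runs_Seq runs_IStore runs_RStore) (simp add: args' Q'[unfolded written_def])
  qed auto
qed

lemma runs_residual_loop:
  assumes init: "ivar \<sigma> ''i'' = 0" "ivar \<sigma> ''m'' = m"
    and Q: "\<And>\<sigma>'. \<lbrakk>residual_frame (\<sigma>\<lparr>ivar := (ivar \<sigma>)(''i'' := m)\<rparr>) \<sigma>';
      \<And>j. j < m \<Longrightarrow>
        stored_residual_arc \<sigma>' j (iarr \<sigma> ''tail'' j) (iarr \<sigma> ''head'' j)
          (rarr \<sigma> ''cap'' j - rarr \<sigma> ''f'' j) \<and>
        stored_residual_arc \<sigma>' (m + j) (iarr \<sigma> ''head'' j) (iarr \<sigma> ''tail'' j)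
          (rarr \<sigma> ''f'' j)\<rbrakk> \<Longrightarrow> Q \<sigma>'"
  shows "runs Opt residual_loop \<sigma> (1 + m * 12) 0 Q"
proof -
  \<comment> \<open>The loop leaves \<open>''tail''\<close>, \<open>''head''\<close>,
    \<open>''cap''\<close> and \<open>''f''\<close> alone, so the invariant can refer to their
    values in \<sigma>. A round costs 1 + 5 + 5 + 1 = 12 steps.\<close>
  define I where "I = (\<lambda>j (\<sigma>' :: store). residual_frame (\<sigma>\<lparr>ivar := (ivar \<sigma>)(''i'' := j)\<rparr>) \<sigma>' \<and>
    (\<forall>l<j. stored_residual_arc \<sigma>' l (iarr \<sigma> ''tail'' l) (iarr \<sigma> ''head'' l)
          (rarr \<sigma> ''cap'' l - rarr \<sigma> ''f'' l) \<and>
        stored_residual_arc \<sigma>' (m + l) (iarr \<sigma> ''head'' l) (iarr \<sigma> ''tail'' l)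
          (rarr \<sigma> ''f'' l)))"
  show ?thesis
    unfolding residual_loop_def
  proof (rule runs_mono[OF runs_While[where N = "m" and I = I and B = "5 + (5 + 1)"]])
    show "I 0 \<sigma>"
      using init by (auto simp: I_def residual_frame_def)
    show "bval (BILess (IVar ''i'') (IVar ''m'')) \<sigma>' \<longleftrightarrow> j < m" if "I j \<sigma>'" for j \<sigma>'
      using that init by (simp add: I_def residual_frame_def)
    show "Q \<sigma>'" if "I (m) \<sigma>'" for \<sigma>'
      using that by (intro Q) (auto simp: I_def)
    fix j \<sigma>' assume j: "j < m" and I: "I j \<sigma>'"
    show "runs Opt
     (Seq (store_residual_arc (IVar ''i'') (IArr ''tail'' (IVar ''i'')) (IArr ''head'' (IVar ''i''))
            (RSub (RArr ''cap'' (IVar ''i'')) (RArr ''f'' (IVar ''i''))))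
     (Seq (store_residual_arc (IAdd (IVar ''m'') (IVar ''i''))
            (IArr ''head'' (IVar ''i'')) (IArr ''tail'' (IVar ''i'')) (RArr ''f'' (IVar ''i'')))
       (IAssign ''i'' (IAdd (IVar ''i'') (IConst 1))))) \<sigma>' (5 + (5 + 1)) 0 (I (Suc j))"
      apply (rule runs_mono[where B = "5 + (5 + 1)" and k = "0 + (0 + 0)" and Q = "I (Suc j)"])
        apply (intro runs_Seq runs_store_residual_arc runs_IAssign)
          apply (simp add: residual_frame_def)
         apply (simp add: residual_frame_def)
      subgoal premises prems for \<sigma>1 \<sigma>2
      proof -
        have \<sigma>': "ivar \<sigma>' = (ivar \<sigma>)(''i'' := j)" "iarr \<sigma>' ''tail'' = iarr \<sigma> ''tail''"
            "iarr \<sigma>' ''head'' = iarr \<sigma> ''head''" "rarr \<sigma>' ''cap'' = rarr \<sigma> ''cap''"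
            "rarr \<sigma>' ''f'' = rarr \<sigma> ''f''"
          using I by (simp_all add: I_def residual_frame_def)
        then have \<sigma>1: "ivar \<sigma>1 = (ivar \<sigma>)(''i'' := j)" "iarr \<sigma>1 ''tail'' = iarr \<sigma> ''tail''"
            "iarr \<sigma>1 ''head'' = iarr \<sigma> ''head''" "rarr \<sigma>1 ''f'' = rarr \<sigma> ''f''"
          using prems(1) by (simp_all add: residual_frame_def)
        have fwd: "stored_residual_arc \<sigma>1 j (iarr \<sigma> ''tail'' j) (iarr \<sigma> ''head'' j)
            (rarr \<sigma> ''cap'' j - rarr \<sigma> ''f'' j)"
          using prems(2) by (simp add: \<sigma>')
        have bwd: "stored_residual_arc \<sigma>2 (m + j) (iarr \<sigma> ''head'' j) (iarr \<sigma> ''tail'' j)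
            (rarr \<sigma> ''f'' j)"
          using prems(5) init(2) by (simp add: \<sigma>1)
        \<comment> \<open>As \<open>j < m\<close>, the slots \<open>j\<close> and
          \<open>m + j\<close> differ from each other and from all slots filled earlier.\<close>
        have old: "stored_residual_arc \<sigma>1 l = stored_residual_arc \<sigma>' l" if "l \<noteq> j" for l
          using prems(3)[of l] that by (simp add: \<sigma>')
        have old': "stored_residual_arc \<sigma>2 l = stored_residual_arc \<sigma>1 l" if "l \<noteq> m + j" for l
          using prems(6)[of l] that init(2) by (simp add: \<sigma>1)
        have "residual_frame (\<sigma>\<lparr>ivar := (ivar \<sigma>)(''i'' := Suc j)\<rparr>)
            (\<sigma>2\<lparr>ivar := (ivar \<sigma>2)(''i'' := ival (IAdd (IVar ''i'') (IConst 1)) \<sigma>2)\<rparr>)"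
          using prems(1,4) I by (simp add: I_def residual_frame_def)
        moreover have "stored_residual_arc (\<sigma>2\<lparr>ivar := x\<rparr>) = stored_residual_arc \<sigma>2" for x
          by (simp add: stored_residual_arc_def)
        ultimately show ?thesis
          using I j fwd bwd by (auto simp: I_def less_Suc_eq old old')
      qed
      by simp_all
  qed auto
qed

lemma runs_update_loop:
  assumes init: "ivar \<sigma> ''i'' = 0" "ivar \<sigma> ''m'' = m"
    and Q: "\<And>\<sigma>'. (\<And>j. j < m \<Longrightarrow> rarr \<sigma>' ''flow'' j = rarr \<sigma> ''f'' j +
      (rarr \<sigma> ''w'' j * rarr \<sigma> ''g'' j -
       rarr \<sigma> ''w'' (m + j) * rarr \<sigma> ''g'' (m + j))) \<Longrightarrow> Q \<sigma>'"
  shows "runs Opt update_loop \<sigma> (1 + m * 3) 0 Q"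
proof -
  define I where "I = (\<lambda>j (\<sigma>' :: store). ivar \<sigma>' = (ivar \<sigma>)(''i'' := j) \<and>
    (\<forall>a. a \<noteq> ''flow'' \<longrightarrow> rarr \<sigma>' a = rarr \<sigma> a) \<and>
    (\<forall>l<j. rarr \<sigma>' ''flow'' l = rarr \<sigma> ''f'' l +
      (rarr \<sigma> ''w'' l * rarr \<sigma> ''g'' l -
       rarr \<sigma> ''w'' (m + l) * rarr \<sigma> ''g'' (m + l))))"
  show ?thesis
    unfolding update_loop_def
  proof (rule runs_mono[OF runs_While[where N = "m" and I = I and B = "1 + 1"]])
    show "I 0 \<sigma>"
      using init by (auto simp: I_def)
    show "bval (BILess (IVar ''i'') (IVar ''m'')) \<sigma>' \<longleftrightarrow> j < m" if "I j \<sigma>'" for j \<sigma>'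
      using that init by (simp add: I_def)
    show "Q \<sigma>'" if "I (m) \<sigma>'" for \<sigma>'
      using that by (intro Q) (auto simp: I_def)
    fix j \<sigma>' assume I: "I j \<sigma>'"
    show "runs Opt (Seq (RStore ''flow'' (IVar ''i'')
            (RAdd (RArr ''f'' (IVar ''i''))
              (RSub (RMul (RArr ''w'' (IVar ''i'')) (RArr ''g'' (IVar ''i'')))
                    (RMul (RArr ''w'' (IAdd (IVar ''m'') (IVar ''i'')))
                          (RArr ''g'' (IAdd (IVar ''m'') (IVar ''i'')))))))
       (IAssign ''i'' (IAdd (IVar ''i'') (IConst 1)))) \<sigma>' (1 + 1) 0 (I (Suc j))"
      apply (rule runs_mono[where B = "1 + 1" and k = "0 + 0" and Q = "I (Suc j)"])
         apply (intro runs_Seq runs_RStore runs_IAssign)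
      using init I by (auto simp: I_def less_Suc_eq)
  qed auto
qed

lemma max_arc_flow_correct:
  assumes N: "flow_network G c s t" and G: "verts G = {..<n}" "arcs G = {..<m}" and e: "e < m"
    and Opt: "max_flow_solver Opt"
  shows "runs Opt max_arc_flow (input_store n m G c s t e) (20 * (n + m)) 2
    (\<lambda>\<sigma>. is_max_flow G c s t (rarr \<sigma> ''flow'') \<and>
      (\<forall>f'. is_max_flow G c s t f' \<longrightarrow> f' e \<le> rarr \<sigma> ''flow'' e))" (is "runs _ _ ?\<sigma>0 _ _ ?P")
proof (rule runs_mono)
  show "runs Opt max_arc_flow ?\<sigma>0
    ((1 + n + m) + (1 + (1 + ((1 + m * 12) + ((1 + (n + 1) + (m + m)) + (1 + (1 + m * 3)))))))
    (1 + (0 + (0 + (0 + (1 + (0 + 0)))))) ?P"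
    unfolding max_arc_flow_def
    apply (rule runs_Seq, rule runs_MaxFlow)
      apply (simp add: input_store_def)
     apply (simp add: input_store_def)
    apply (rule runs_Seq, rule runs_IAssign, rule runs_Seq, rule runs_IStore)
    apply (rule runs_Seq, rule runs_residual_loop)
      apply (simp add: input_store_def)
     apply (simp add: input_store_def)
    apply (rule runs_Seq, rule runs_MaxFlow)
      apply (simp add: input_store_def residual_frame_def)
     apply (simp add: input_store_def residual_frame_def)
    apply (rule runs_Seq, rule runs_IAssign, rule runs_update_loop)
      apply simp
     apply (simp add: input_store_def residual_frame_def)
    \<comment> \<open>After symbolic execution: \<open>f\<close> and \<open>g\<close> are the two
      answers of the solver, \<sigma> is the store after the residual loop and \<sigma>' the final
      one.\<close>
    subgoal premises prems for f \<sigma> g \<sigma>'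
    proof -
      note ends = flow_network_ends_less[OF N G]
      define H where "H = \<lparr>verts = {..<Suc n}, arcs = {..<m + m},
        tail = iarr \<sigma> ''rtail'', head = iarr \<sigma> ''rhead''\<rparr>"
      have f: "f = Opt \<lparr>verts = {..<n}, arcs = {..<m}, tail = iarr ?\<sigma>0 ''tail'',
          head = iarr ?\<sigma>0 ''head''\<rparr> (rarr ?\<sigma>0 ''cap'') s t"
        using prems(1) by (simp add: input_store_def)
      have g: "g = Opt H (rarr \<sigma> ''rcap'') n (tail G e)"
        using prems(2,4) e by (simp add: input_store_def residual_frame_def H_def)
      have \<sigma>: "stored_residual_arc \<sigma> j (((tail G)(e := n)) j) (head G j) (c j - f j)"
        "stored_residual_arc \<sigma> (m + j) (head G j) (((tail G)(e := n)) j) (f j)" if "j < m" for j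
        using prems(3)[OF that] that by (simp_all add: input_store_def split: if_splits)
      have flow: "rarr \<sigma>' ''flow'' j
          = f j + (rarr \<sigma> ''w'' j * g j - rarr \<sigma> ''w'' (m + j) * g (m + j))" if "j < m" for j
        using prems(5)[OF that] prems(2) that by (simp add: input_store_def residual_frame_def)
      have "is_max_flow \<lparr>verts = {..<n}, arcs = {..<m}, tail = iarr ?\<sigma>0 ''tail'',
          head = iarr ?\<sigma>0 ''head''\<rparr> (rarr ?\<sigma>0 ''cap'') s t f"
        unfolding f using N G ends
        by (intro Opt[unfolded max_flow_solver_def, rule_format] flow_networkI)
          (auto simp: input_store_def flow_network_def)
      then have f_max: "is_max_flow G c s t f"
        by (rule is_max_flow_cong[THEN iffD1, rotated -1]) (auto simp: G input_store_def)
      \<comment> \<open>The solver promises something only on flow networks: placeholders are loops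
        at vertex 0 with capacity 1, and the source \<open>n\<close> differs from the sink, which is
        below \<open>n\<close>.\<close>
      have "iarr \<sigma> ''rtail'' i < Suc n \<and> iarr \<sigma> ''rhead'' i < Suc n \<and> 0 < rarr \<sigma> ''rcap'' i"
        if i: "i < m + m" for i
      proof (cases "i < m")
        case True
        then show ?thesis
          using \<sigma>(1)[OF True] ends[OF True]
          by (auto simp: stored_residual_arc_def residual_arc_def split: if_splits)
      next
        case False
        then have "i = m + (i - m)" "i - m < m" using i by auto
        then show ?thesis
          using \<sigma>(2)[of "i - m"] ends[of "i - m"]
          by (auto simp: stored_residual_arc_def residual_arc_def split: if_splits)
      qed
      then have "is_max_flow H (rarr \<sigma> ''rcap'') n (tail G e) g"
        unfolding g using ends[OF e] unfolding H_def
        by (intro Opt[unfolded max_flow_solver_def, rule_format] flow_networkI) auto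
      then have "is_max_flow G c s t (\<lambda>j. f j + (rarr \<sigma> ''w'' j * g j - rarr \<sigma> ''w'' (m + j) * g (m + j)))
        \<and> (\<forall>f'. is_max_flow G c s t f' \<longrightarrow>
          f' e \<le> f e + (rarr \<sigma> ''w'' e * g e - rarr \<sigma> ''w'' (m + e) * g (m + e)))"
        using \<sigma> by (intro max_flow_improve_arc[OF N G e f_max, of H "rarr \<sigma> ''rcap''"])
          (auto simp: H_def stored_residual_arc_def)
      then show "?P \<sigma>'"
        using flow[OF e] is_max_flow_cong[OF G G refl refl refl flow] by simp
    qed
    done
  \<comment> \<open>The steps add up to \<open>2 * n + 18 * m + 8\<close>; as \<open>n\<close> is
    positive, \<open>18 * n\<close> absorbs the 8.\<close>
  have "0 < n" using N G by (auto simp: flow_network_def)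
  then show "(1 + n + m) + (1 + (1 + ((1 + m * 12) + ((1 + (n + 1) + (m + m)) + (1 + (1 + m * 3))))))
      \<le> 20 * (n + m)" by (auto simp: gr0_conv_Suc)
qed auto

theorem theorem15:
  shows "\<exists>(p :: com) (K :: nat). \<forall>(n :: nat) (m :: nat) (G :: (nat, nat) pre_digraph)
      (c :: nat \<Rightarrow> real) (s :: nat) (t :: nat).
    flow_network G c s t \<and> verts G = {..<n} \<and> arcs G = {..<m} \<longrightarrow>
    (\<forall>e\<in>arcs G. \<forall>Opt. max_flow_solver Opt \<longrightarrow>
      (\<exists>\<sigma> T. exec Opt p (input_store n m G c s t e) \<sigma> T 2 \<and> T \<le> K * (n + m) \<and>
        (let f = rarr \<sigma> ''flow'' in
          is_max_flow G c s t f \<and> (\<forall>f'. is_max_flow G c s t f' \<longrightarrow> f e \<ge> f' e))))"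
proof (rule exI[of _ max_arc_flow], rule exI[of _ 20], intro allI impI ballI, elim conjE)
  fix n m s t e :: nat and G c Opt
  assume "flow_network G c s t" "verts G = {..<n}" "arcs G = {..<m}" "e \<in> arcs G"
    "max_flow_solver Opt"
  then show "\<exists>\<sigma> T. exec Opt max_arc_flow (input_store n m G c s t e) \<sigma> T 2 \<and> T \<le> 20 * (n + m) \<and>
        (let f = rarr \<sigma> ''flow'' in
          is_max_flow G c s t f \<and> (\<forall>f'. is_max_flow G c s t f' \<longrightarrow> f e \<ge> f' e))"
    using max_arc_flow_correct[of G c s t n m e Opt] by (simp add: runs_def Let_def)
qed

end
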